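(* Let $d\ge 2$, $1\le K\le d$ and $N\ge 1$ be integers, let $\mathcal{S}\subset\mathbb{R}^d$, and let $f=(f_1,\dots,f_d):\mathcal{S}\to\mathbb{R}^d$ be the dynamical law of a $K$-mode interacting system with separation rank $N$. Then: 1. Each $f_k$, $k\in[d]$, admits a tensor train (TT) representation with rank $$r\le N\binom{d-1}{K-1}=N\,\mathcal{O}(d^{K-1}).$$ 2. The function $f$ admits a TT representation with ranks $r_k$, $k\in[d-1]$, satisfying $$r_k\le c_2(N,d,k)+k\binom{k-1}{K-1}+1,$$ where $$c_2(N,d,k)=N\left[d\binom{d-1}{K-1}-k\binom{k-1}{K-1}-(d-k)\binom{d-k-1}{K-1}\right]=\mathcal{O}(Nd^K).$$ (The $\mathcal{O}$ statements are for fixed $K$ as $d\to\infty$.)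
   Context: Notation: $[n]=\{1,\dots,n\}$; $\binom{n}{m}=0$ if $m>n$. $K$-mode interacting system with separation rank $N$: a dynamical law $f:\mathcal{S}\subset\mathbb{R}^d\to\mathbb{R}^d$ for which there exist a finite set of univariate functions $\{g_i:\mathbb{R}\to\mathbb{R}\}_{i=1}^{\tilde p}$ and, for each $k\in[d]$, a non-negative integer $\mathcal{K}_k$ together with, for $\ell\in[\mathcal{K}_k]$, pairwise distinct subsets $\mathcal{J}^{(k)}_\ell=\{j_1,\dots,j_K\}\subset[d]$ of cardinality $K$ with $k\in\mathcal{J}^{(k)}_\ell$, and index sets $\mathcal{I}^{(k)}_\ell\subset[\tilde p]^K$ with $|\mathcal{I}^{(k)}_\ell|\le N$, such that $$f_k(x)=\sum_{\ell\in[\mathcal{K}_k]}\ \sum_{(i_{j_1},\dots,i_{j_K})\in\mathcal{I}^{(k)}_\ell}g_{i_{j_1}}(x_{j_1})\cdots g_{i_{j_K}}(x_{j_K}).$$ TT representations: fix a function dictionary, i.e. finitely many linearly independent functions $\Psi_1,\dots,\Psi_p:\mathbb{R}\to\mathbb{R}$, whose span is assumed to contain the constant function $1$ and all the $g_i$, and let $\Phi_{i_1,\dots,i_d}(x)=\Psi_{i_1}(x_1)\cdots\Psi_{i_d}(x_d)$. A function $h:\mathcal{S}\to\mathbb{R}$ admits a TT representation with ranks $r_1,\dots,r_{d-1}$ if $h(x)=\sum_{i_1,\dots,i_d\in[p]}\Theta_{i_1,\dots,i_d}\Phi_{i_1,\dots,i_d}(x)$ on $\mathcal{S}$ for a real tensor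 $\Theta$ of the form $$\Theta_{i_1,\dots,i_d}=\sum_{j_1\in[r_1],\dots,j_{d-1}\in[r_{d-1}]}(C_1)^{i_1}_{j_1}(C_2)^{i_2}_{j_1,j_2}\cdots(C_d)^{i_d}_{j_{d-1}}$$ with real tensors $C_1,\dots,C_d$. Having a TT representation with rank $r$ means that this is possible with $r_j\le r$ for all $j\in[d-1]$. The vector-valued function $f:\mathcal{S}\to\mathbb{R}^d$ admits a TT representation with ranks $r_1,\dots,r_{d-1}$ if $f_m(x)=\sum_{i_1,\dots,i_d\in[p]}\Theta_{m;i_1,\dots,i_d}\Phi_{i_1,\dots,i_d}(x)$ on $\mathcal{S}$ for all $m\in[d]$, where $$\Theta_{m;i_1,\dots,i_d}=\sum_{j_1\in[r_1],\dots,j_{d-1}\in[r_{d-1}]}(C_1)^{i_1}_{j_1}(C_2)^{i_2}_{j_1,j_2}\cdots(C_{d-1})^{i_{d-1}}_{j_{d-2},j_{d-1}}(C_d)^{i_d}_{j_{d-1},m},$$ i.e. the output index $m$ is carried as an additional index of the last core only. *)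

theory Defs
  imports
    Complex_Main
    "HOL-Library.FuncSet"
    "HOL-Library.Function_Algebras"
    "HOL-Library.Landau_Symbols"
begin

text \<open>
  The real vector space of functions from the reals to the reals, for linear independence
  and spans of univariate functions.
\<close>

global_interpretation real_fun: vector_space "\<lambda>(c::real) (h :: real \<Rightarrow> real) x. c * h x"
  by unfold_locales (auto simp: fun_eq_iff algebra_simps)

text \<open>
  Points of $d$-dimensional space are functions on the index set \<open>{1..d}\<close>, and a law is the
  family \<open>f k\<close> of its components.
  A tuple $(i_{j_1},\dots,i_{j_K})$ whose entries are labelled by the elements of
  $J = \{j_1,\dots,j_K\}$ is an element of the extensional function space
  \<open>J \<rightarrow>\<^sub>E {1..q}\<close>; since \<open>J\<close> is finite, so is every set of such tuples, and the bound on
  its \<open>card\<close> is a genuine one.  The univariate functions \<open>g 1, \<dots>, g q\<close> are an argument,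
  because the dictionary of a tensor train representation has to refer to them.
\<close>

definition kmode_interacting_system ::
  "nat \<Rightarrow> (nat \<Rightarrow> real) set \<Rightarrow> nat \<Rightarrow> nat \<Rightarrow> nat \<Rightarrow> (nat \<Rightarrow> real \<Rightarrow> real) \<Rightarrow>
     (nat \<Rightarrow> (nat \<Rightarrow> real) \<Rightarrow> real) \<Rightarrow> bool"
  where "kmode_interacting_system d S K N q g f \<longleftrightarrow>
    (\<forall>k\<in>{1..d}. \<exists>(L::nat) (J :: nat \<Rightarrow> nat set) (I :: nat \<Rightarrow> (nat \<Rightarrow> nat) set).
       inj_on J {1..L} \<and>
       (\<forall>l\<in>{1..L}. J l \<subseteq> {1..d} \<and> card (J l) = K \<and> k \<in> J l \<and>
          I l \<subseteq> (J l \<rightarrow>\<^sub>E {1..q}) \<and> card (I l) \<le> N) \<and>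
       (\<forall>x\<in>S. f k x = (\<Sum>l\<in>{1..L}. \<Sum>i\<in>I l. \<Prod>j\<in>J l. g (i j) (x j))))"

definition dictionary_expansion ::
  "nat \<Rightarrow> nat \<Rightarrow> (nat \<Rightarrow> real \<Rightarrow> real) \<Rightarrow> ((nat \<Rightarrow> nat) \<Rightarrow> real) \<Rightarrow> (nat \<Rightarrow> real) \<Rightarrow> real"
  where "dictionary_expansion d p \<Psi> \<Theta> x =
    (\<Sum>i\<in>{1..d} \<rightarrow>\<^sub>E {1..p}. \<Theta> i * (\<Prod>k\<in>{1..d}. \<Psi> (i k) (x k)))"

text \<open>
  Core entries carry the dictionary index first: \<open>C1 i j\<close>, \<open>C k i j j'\<close> for \<open>2 \<le> k \<le> d - 1\<close>,
  and \<open>Cd i j\<close>.  This is meaningful for \<open>d \<ge> 2\<close>.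
\<close>

definition tt_tensor ::
  "nat \<Rightarrow> (nat \<Rightarrow> nat) \<Rightarrow> (nat \<Rightarrow> nat \<Rightarrow> real) \<Rightarrow> (nat \<Rightarrow> nat \<Rightarrow> nat \<Rightarrow> nat \<Rightarrow> real) \<Rightarrow>
     (nat \<Rightarrow> nat \<Rightarrow> real) \<Rightarrow> (nat \<Rightarrow> nat) \<Rightarrow> real"
  where "tt_tensor d r C1 C Cd i =
    (\<Sum>j\<in>(\<Pi>\<^sub>E k\<in>{1..d-1}. {1..r k}).
       C1 (i 1) (j 1) * (\<Prod>k\<in>{2..d-1}. C k (i k) (j (k-1)) (j k)) * Cd (i d) (j (d-1)))"

definition has_tt_representation ::
  "nat \<Rightarrow> nat \<Rightarrow> (nat \<Rightarrow> real \<Rightarrow> real) \<Rightarrow> (nat \<Rightarrow> real) set \<Rightarrow> ((nat \<Rightarrow> real) \<Rightarrow> real) \<Rightarrow>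
     (nat \<Rightarrow> nat) \<Rightarrow> bool"
  where "has_tt_representation d p \<Psi> S h r \<longleftrightarrow>
    (\<exists>C1 C Cd. \<forall>x\<in>S. h x = dictionary_expansion d p \<Psi> (tt_tensor d r C1 C Cd) x)"

definition has_tt_representation_rank ::
  "nat \<Rightarrow> nat \<Rightarrow> (nat \<Rightarrow> real \<Rightarrow> real) \<Rightarrow> (nat \<Rightarrow> real) set \<Rightarrow> ((nat \<Rightarrow> real) \<Rightarrow> real) \<Rightarrow>
     nat \<Rightarrow> bool"
  where "has_tt_representation_rank d p \<Psi> S h r \<longleftrightarrow>
    (\<exists>\<rho>. (\<forall>j\<in>{1..d-1}. \<rho> j \<le> r) \<and> has_tt_representation d p \<Psi> S h \<rho>)"

text \<open>
  In the vector-valued case all components share the cores; only the last core \<open>Cd i j m\<close>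
  depends on the output index \<open>m\<close>.
\<close>

definition has_vector_tt_representation ::
  "nat \<Rightarrow> nat \<Rightarrow> (nat \<Rightarrow> real \<Rightarrow> real) \<Rightarrow> (nat \<Rightarrow> real) set \<Rightarrow>
     (nat \<Rightarrow> (nat \<Rightarrow> real) \<Rightarrow> real) \<Rightarrow> (nat \<Rightarrow> nat) \<Rightarrow> bool"
  where "has_vector_tt_representation d p \<Psi> S f r \<longleftrightarrow>
    (\<exists>C1 C Cd. \<forall>m\<in>{1..d}. \<forall>x\<in>S.
       f m x = dictionary_expansion d p \<Psi> (tt_tensor d r C1 C (\<lambda>i j. Cd i j m)) x)"

text \<open>
  The outer subtractions are taken in the reals, so they do not truncate.
\<close>

definition c2 :: "nat \<Rightarrow> nat \<Rightarrow> nat \<Rightarrow> nat \<Rightarrow> real"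
  where "c2 K N d k =
    real N * (real (d * ((d - 1) choose (K - 1)))
      - real (k * ((k - 1) choose (K - 1)))
      - real ((d - k) * ((d - k - 1) choose (K - 1))))"

text \<open>
  The filter \<open>d \<rightarrow> \<infinity>\<close> on triples \<open>(N, d, k)\<close> with \<open>N \<ge> 1\<close> and \<open>1 \<le> k \<le> d - 1\<close>: a Landau
  bound along it is uniform in \<open>N\<close> and \<open>k\<close>.
\<close>

definition uniform_dim_at_top :: "(nat \<times> nat \<times> nat) filter"
  where "uniform_dim_at_top =
    inf (filtercomap (\<lambda>(N, d, k). d) at_top) (principal {(N, d, k). 1 \<le> N \<and> k \<in> {1..d-1}})"

end

theory Submission
  imports Defs
begin

text \<open>
  Cut the variables $x_1,\dots,x_d$ after position $k$.  A tensor train passes from one cut to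
  the next by multiplying with functions of the single variable $x_k$ and summing, so it exists
  with ranks $r_k$ as soon as there are families $F_0 = \{1\}, F_1, \dots, F_{d-1}$ with
  $|F_k| = r_k$ such that every member of $F_k$, and in the end every output, is a combination
  of the members of the preceding family whose coefficients are functions of the new variable
  in the span of the dictionary (\<open>vector_tt_from_nested_families\<close>).  Finding
  cores thus becomes finding small families of functions of the left variables.

  A single component $f_m$ is a sum of at most $N\binom{d-1}{K-1}$ products, because there are
  $\binom{d-1}{K-1}$ sets of $K$ modes containing $m$, with at most $N$ products each.  Take for $F_k$ the partial products over
  the modes up to $k$; each is obtained from its predecessor by one factor, either some $g_i$
  or the constant $1$.

  For all components together, sort the products by the position of their mode set $J$ relative
  to the cut.  If $J$ lies to the right, nothing has been multiplied yet and the shared state $1$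
  suffices.  If $J$ crosses the cut, its partial product is a state of its own; $c_2(N,d,k)$
  bounds the number of these, as it is $N$ times the number of pairs $(m,J)$ with $m \in J$, $J$
  crossing (\<open>card_crossing_sets\<close>).  If $J$ lies to the left, the product is finished,
  and all finished products of the same component are added up in one state.  A finished product
  needs $K \le k$ and belongs to some $m \le k$, so there are at most
  $k \le k\binom{k-1}{K-1}$ such states, and none if $k < K$.
  At $k = d$ everything is finished, and the sum for $m$ is $f_m$
  (\<open>left_component_in_extension\<close>).
\<close>

section \<open>Tensor trains from nested families of functions\<close>

text \<open>
  Since the basis functions factor over the modes, the sum over the dictionary indices can be
  taken inside each core: a tensor train is a product of matrices of functions, the \<open>k\<close>-th
  depending on the \<open>k\<close>-th variable only.
\<close>

lemma dictionary_expansion_tt_tensor: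
  assumes "2 \<le> d"
  shows "dictionary_expansion d p \<Psi> (tt_tensor d r C1 C Cd) x =
    (\<Sum>j\<in>(\<Pi>\<^sub>E k\<in>{1..d-1}. {1..r k}).
       (\<Sum>i\<in>{1..p}. C1 i (j 1) * \<Psi> i (x 1)) *
       (\<Prod>k\<in>{2..d-1}. \<Sum>i\<in>{1..p}. C k i (j (k-1)) (j k) * \<Psi> i (x k)) *
       (\<Sum>i\<in>{1..p}. Cd i (j (d-1)) * \<Psi> i (x d)))"
proof -
  have modes: "{1..d} = insert 1 (insert d {2..d-1})" "1 \<notin> insert d {2..d-1}" "d \<notin> {2..d-1}"
    using assms by auto
  have summand:
    "(\<Sum>i\<in>{1..d} \<rightarrow>\<^sub>E {1..p}.
        C1 (i 1) (j 1) * (\<Prod>k\<in>{2..d-1}. C k (i k) (j (k-1)) (j k)) * Cd (i d) (j (d-1)) *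
        (\<Prod>k\<in>{1..d}. \<Psi> (i k) (x k))) =
      (\<Sum>i\<in>{1..p}. C1 i (j 1) * \<Psi> i (x 1)) *
      (\<Prod>k\<in>{2..d-1}. \<Sum>i\<in>{1..p}. C k i (j (k-1)) (j k) * \<Psi> i (x k)) *
      (\<Sum>i\<in>{1..p}. Cd i (j (d-1)) * \<Psi> i (x d))" for j
  proof -
    define u where "u k i = (if k = 1 then C1 i (j 1) else if k = d then Cd i (j (d-1))
                             else C k i (j (k-1)) (j k)) * \<Psi> i (x k)" for k i
    have u_mid: "u k = (\<lambda>i. C k i (j (k-1)) (j k) * \<Psi> i (x k))" if "k \<in> {2..d-1}" for k
      using that by (auto simp: u_def fun_eq_iff)
    have u_ends: "u 1 = (\<lambda>i. C1 i (j 1) * \<Psi> i (x 1))" "u d = (\<lambda>i. Cd i (j (d-1)) * \<Psi> i (x d))"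
      using assms by (auto simp: u_def fun_eq_iff)
    have split: "(\<Prod>k\<in>{1..d}. F k) = F 1 * (\<Prod>k\<in>{2..d-1}. F k) * F d" for F :: "nat \<Rightarrow> real"
      using modes by (simp add: mult.commute mult.left_commute)
    have "(\<Prod>k\<in>{1..d}. \<Sum>i\<in>{1..p}. u k i) = (\<Sum>i\<in>{1..d} \<rightarrow>\<^sub>E {1..p}. \<Prod>k\<in>{1..d}. u k (i k))"
      by (rule prod_sum_PiE) auto
    moreover have "(\<Prod>k\<in>{1..d}. \<Sum>i\<in>{1..p}. u k i) =
      (\<Sum>i\<in>{1..p}. C1 i (j 1) * \<Psi> i (x 1)) *
      (\<Prod>k\<in>{2..d-1}. \<Sum>i\<in>{1..p}. C k i (j (k-1)) (j k) * \<Psi> i (x k)) *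
      (\<Sum>i\<in>{1..p}. Cd i (j (d-1)) * \<Psi> i (x d))"
      unfolding split u_ends by (simp only: u_mid cong: prod.cong)
    moreover have "(\<Prod>k\<in>{1..d}. u k (i k)) =
        C1 (i 1) (j 1) * (\<Prod>k\<in>{2..d-1}. C k (i k) (j (k-1)) (j k)) * Cd (i d) (j (d-1)) *
        (\<Prod>k\<in>{1..d}. \<Psi> (i k) (x k))" for i
    proof -
      have "(\<Prod>k\<in>{2..d-1}. u k (i k)) =
        (\<Prod>k\<in>{2..d-1}. C k (i k) (j (k-1)) (j k)) * (\<Prod>k\<in>{2..d-1}. \<Psi> (i k) (x k))"
        by (simp only: u_mid prod.distrib cong: prod.cong)
      thus ?thesis unfolding split u_ends by (simp add: algebra_simps)
    qed
    ultimately show ?thesis by simp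
  qed
  have "dictionary_expansion d p \<Psi> (tt_tensor d r C1 C Cd) x =
    (\<Sum>i\<in>{1..d} \<rightarrow>\<^sub>E {1..p}. \<Sum>j\<in>(\<Pi>\<^sub>E k\<in>{1..d-1}. {1..r k}).
        C1 (i 1) (j 1) * (\<Prod>k\<in>{2..d-1}. C k (i k) (j (k-1)) (j k)) * Cd (i d) (j (d-1)) *
        (\<Prod>k\<in>{1..d}. \<Psi> (i k) (x k)))"
    unfolding dictionary_expansion_def tt_tensor_def by (simp add: sum_distrib_right)
  also have "\<dots> = (\<Sum>j\<in>(\<Pi>\<^sub>E k\<in>{1..d-1}. {1..r k}). \<Sum>i\<in>{1..d} \<rightarrow>\<^sub>E {1..p}.
        C1 (i 1) (j 1) * (\<Prod>k\<in>{2..d-1}. C k (i k) (j (k-1)) (j k)) * Cd (i d) (j (d-1)) *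
        (\<Prod>k\<in>{1..d}. \<Psi> (i k) (x k)))"
    by (rule sum.swap)
  finally show ?thesis by (simp only: summand)
qed

text \<open>
  The sum over all index paths is evaluated from left to right, like a product of matrices.
  The free weight \<open>w\<close> makes the induction work: the step absorbs the last factor into it,
  and in a tensor train it is the last core.
\<close>

lemma sum_over_paths:
  fixes A :: "nat \<Rightarrow> nat \<Rightarrow> real" and G :: "nat \<Rightarrow> nat \<Rightarrow> nat \<Rightarrow> real"
  assumes "1 \<le> n"
    and "\<And>k b. k \<in> {2..n} \<Longrightarrow> b \<in> {1..r k} \<Longrightarrow> A k b = (\<Sum>a\<in>{1..r (k-1)}. A (k-1) a * G k a b)"
  shows "(\<Sum>j\<in>(\<Pi>\<^sub>E k\<in>{1..n}. {1..r k}). A 1 (j 1) * (\<Prod>k\<in>{2..n}. G k (j (k-1)) (j k)) * w (j n)) =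
    (\<Sum>b\<in>{1..r n}. A n b * w b)"
  using assms
proof (induction n arbitrary: w rule: dec_induct)
  case base
  have "(\<Pi>\<^sub>E k\<in>{1..1}. {1..r k}) = (\<lambda>b k. if k = 1 then b else undefined) ` {1..r 1}"
    by (auto simp: PiE_iff extensional_def image_iff fun_eq_iff split: if_splits)
  moreover have "inj_on (\<lambda>b k::nat. if k = 1 then b else undefined) {1..r 1}"
    by (auto intro!: inj_onI dest: fun_cong[of _ _ 1])
  ultimately show ?case by (simp only: sum.reindex) simp
next
  case (step n)
  have rec: "A (Suc n) b = (\<Sum>a\<in>{1..r n}. A n a * G (Suc n) a b)" if "b \<in> {1..r (Suc n)}" for b
    using step.prems[of "Suc n" b] step.hyps that by simp
  have new: "{1..Suc n} = insert (Suc n) {1..n}" "{2..Suc n} = insert (Suc n) {2..n}"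
    using step.hyps by auto
  have notin: "Suc n \<notin> {1..n}" by simp
  let ?t = "\<lambda>j. A 1 (j 1) * (\<Prod>k\<in>{2..Suc n}. G k (j (k-1)) (j k)) * w (j (Suc n))"
  have extend: "?t (j(Suc n := b)) =
      A 1 (j 1) * (\<Prod>k\<in>{2..n}. G k (j (k-1)) (j k)) * (G (Suc n) (j n) b * w b)" for j b
  proof -
    have "(\<Prod>k\<in>{2..n}. G k ((j(Suc n := b)) (k-1)) ((j(Suc n := b)) k)) =
        (\<Prod>k\<in>{2..n}. G k (j (k-1)) (j k))"
      by (rule prod.cong) auto
    thus ?thesis using step.hyps unfolding new(2) by simp
  qed
  have "(\<Sum>j\<in>(\<Pi>\<^sub>E k\<in>{1..Suc n}. {1..r k}). ?t j) =
    (\<Sum>(b, j)\<in>{1..r (Suc n)} \<times> (\<Pi>\<^sub>E k\<in>{1..n}. {1..r k}). ?t (j(Suc n := b)))"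
    unfolding new(1) PiE_insert_eq
    by (subst sum.reindex[OF inj_combinator[OF notin]]) (simp only: o_def case_prod_unfold)
  also have "\<dots> = (\<Sum>(b, j)\<in>{1..r (Suc n)} \<times> (\<Pi>\<^sub>E k\<in>{1..n}. {1..r k}).
          A 1 (j 1) * (\<Prod>k\<in>{2..n}. G k (j (k-1)) (j k)) * (G (Suc n) (j n) b * w b))"
    by (simp only: extend)
  also have "\<dots> = (\<Sum>b\<in>{1..r (Suc n)}. \<Sum>j\<in>(\<Pi>\<^sub>E k\<in>{1..n}. {1..r k}).
          A 1 (j 1) * (\<Prod>k\<in>{2..n}. G k (j (k-1)) (j k)) * (G (Suc n) (j n) b * w b))"
    by (simp add: sum.cartesian_product)
  also have "\<dots> = (\<Sum>b\<in>{1..r (Suc n)}. \<Sum>a\<in>{1..r n}. A n a * (G (Suc n) a b * w b))"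
    using step.prems by (intro sum.cong refl step.IH) auto
  also have "\<dots> = (\<Sum>b\<in>{1..r (Suc n)}. A (Suc n) b * w b)"
    by (simp add: rec sum_distrib_right mult.assoc)
  finally show ?case .
qed

text \<open>
  What one core can produce from the functions in \<open>F\<close>.  Only the values on \<open>S\<close> count, because
  the outputs of a law are sums of products there and arbitrary elsewhere.
\<close>

definition one_mode_extension ::
  "nat \<Rightarrow> (nat \<Rightarrow> real \<Rightarrow> real) \<Rightarrow> (nat \<Rightarrow> real) set \<Rightarrow> nat \<Rightarrow> ((nat \<Rightarrow> real) \<Rightarrow> real) set \<Rightarrow>
     ((nat \<Rightarrow> real) \<Rightarrow> real) set"
  where "one_mode_extension p \<Psi> S k F =
    {h. \<exists>c. \<forall>x\<in>S. h x = (\<Sum>a\<in>F. a x * (\<Sum>i\<in>{1..p}. c a i * \<Psi> i (x k)))}"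

definition extension_coefficients ::
  "nat \<Rightarrow> (nat \<Rightarrow> real \<Rightarrow> real) \<Rightarrow> (nat \<Rightarrow> real) set \<Rightarrow> nat \<Rightarrow> ((nat \<Rightarrow> real) \<Rightarrow> real) set \<Rightarrow>
     ((nat \<Rightarrow> real) \<Rightarrow> real) \<Rightarrow> ((nat \<Rightarrow> real) \<Rightarrow> real) \<Rightarrow> nat \<Rightarrow> real"
  where "extension_coefficients p \<Psi> S k F h =
    (SOME c. \<forall>x\<in>S. h x = (\<Sum>a\<in>F. a x * (\<Sum>i\<in>{1..p}. c a i * \<Psi> i (x k))))"

lemma extension_coefficients:
  assumes "h \<in> one_mode_extension p \<Psi> S k F" and "x \<in> S"
  shows "h x =
    (\<Sum>a\<in>F. a x * (\<Sum>i\<in>{1..p}. extension_coefficients p \<Psi> S k F h a i * \<Psi> i (x k)))"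
proof -
  have "\<exists>c. \<forall>x\<in>S. h x = (\<Sum>a\<in>F. a x * (\<Sum>i\<in>{1..p}. c a i * \<Psi> i (x k)))"
    using assms(1) by (simp add: one_mode_extension_def)
  from someI_ex[OF this] show ?thesis
    using assms(2) unfolding extension_coefficients_def by (rule bspec)
qed

text \<open>
  The entries of the \<open>k\<close>-th core are the dictionary coefficients that express the members of
  \<open>F k\<close> by those of \<open>F (k - 1)\<close>.  Summing over the paths up to a cut then gives back the
  members of the family at that cut, so the last core yields the outputs.
\<close>

theorem vector_tt_from_nested_families:
  assumes d: "2 \<le> d"
    and F0: "F 0 = {\<lambda>_. 1}"
    and fin: "\<And>k. k \<in> {1..d-1} \<Longrightarrow> finite (F k)"
    and nested: "\<And>k. k \<in> {1..d-1} \<Longrightarrow> F k \<subseteq> one_mode_extension p \<Psi> S k (F (k-1))"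
    and last: "\<And>m. m \<in> {1..d} \<Longrightarrow> f m \<in> one_mode_extension p \<Psi> S d (F (d-1))"
  shows "has_vector_tt_representation d p \<Psi> S f (\<lambda>k. card (F k))"
proof -
  \<comment> \<open>Core indices are natural numbers, so each family has to be enumerated.\<close>
  have "\<forall>k\<in>{1..d-1}. \<exists>e. bij_betw e {1..card (F k)} (F k)"
    using fin ex_bij_betw_nat_finite_1 by blast
  then obtain e where e: "\<And>k. k \<in> {1..d-1} \<Longrightarrow> bij_betw (e k) {1..card (F k)} (F k)"
    by metis
  have sum_e: "(\<Sum>a\<in>F k. \<phi> a) = (\<Sum>a\<in>{1..card (F k)}. \<phi> (e k a))"
    if "k \<in> {1..d-1}" for k and \<phi> :: "_ \<Rightarrow> real"
    using sum.reindex_bij_betw[OF e[OF that], of \<phi>] by simp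
  define c where "c k = extension_coefficients p \<Psi> S k (F (k-1))" for k
  have c: "b x = (\<Sum>a\<in>F (k-1). a x * (\<Sum>i\<in>{1..p}. c k b a i * \<Psi> i (x k)))"
    if "k \<in> {1..d-1}" "b \<in> F k" "x \<in> S" for k b x
    unfolding c_def using nested that by (blast intro: extension_coefficients)
  have cd: "f m x = (\<Sum>a\<in>F (d-1). a x * (\<Sum>i\<in>{1..p}. c d (f m) a i * \<Psi> i (x d)))"
    if "m \<in> {1..d}" "x \<in> S" for m x
    unfolding c_def using last that by (blast intro: extension_coefficients)
  \<comment> \<open>The first core has no left index; it belongs to the only member of \<open>F 0\<close>.\<close>
  define C1 where "C1 i j = c 1 (e 1 j) (\<lambda>_. 1) i" for i j
  define C where "C k i j j' = c k (e k j') (e (k-1) j) i" for k i j j'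
  define Cd where "Cd i j m = c d (f m) (e (d-1) j) i" for i j m
  have "f m x = dictionary_expansion d p \<Psi> (tt_tensor d (\<lambda>k. card (F k)) C1 C (\<lambda>i j. Cd i j m)) x"
    if m: "m \<in> {1..d}" and x: "x \<in> S" for m x
  proof -
    have eF: "e k b \<in> F k" if "k \<in> {1..d-1}" "b \<in> {1..card (F k)}" for k b
      using e[OF that(1)] that(2) by (auto dest: bij_betwE)
    have first: "(\<Sum>i\<in>{1..p}. C1 i b * \<Psi> i (x 1)) = e 1 b x" if "b \<in> {1..card (F 1)}" for b
      using c[of 1 "e 1 b" x] eF[of 1 b] d x that by (simp add: F0 C1_def)
    have rec: "e k b x =
        (\<Sum>a\<in>{1..card (F (k-1))}. e (k-1) a x * (\<Sum>i\<in>{1..p}. C k i a b * \<Psi> i (x k)))"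
      if "k \<in> {2..d-1}" "b \<in> {1..card (F k)}" for k b
    proof -
      have k: "k \<in> {1..d-1}" "k - 1 \<in> {1..d-1}" using that by auto
      show ?thesis
        using c[OF k(1) eF[OF k(1) that(2)] x] sum_e[OF k(2)] by (simp add: C_def)
    qed
    have "dictionary_expansion d p \<Psi> (tt_tensor d (\<lambda>k. card (F k)) C1 C (\<lambda>i j. Cd i j m)) x =
      (\<Sum>j\<in>(\<Pi>\<^sub>E k\<in>{1..d-1}. {1..card (F k)}).
         e 1 (j 1) x *
         (\<Prod>k\<in>{2..d-1}. \<Sum>i\<in>{1..p}. C k i (j (k-1)) (j k) * \<Psi> i (x k)) *
         (\<Sum>i\<in>{1..p}. Cd i (j (d-1)) m * \<Psi> i (x d)))"
      unfolding dictionary_expansion_tt_tensor[OF d]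
    proof (intro sum.cong refl)
      fix j assume "j \<in> (\<Pi>\<^sub>E k\<in>{1..d-1}. {1..card (F k)})"
      hence "j 1 \<in> {1..card (F 1)}" using d by (auto simp: PiE_iff)
      from first[OF this] show "(\<Sum>i\<in>{1..p}. C1 i (j 1) * \<Psi> i (x 1)) *
         (\<Prod>k\<in>{2..d-1}. \<Sum>i\<in>{1..p}. C k i (j (k-1)) (j k) * \<Psi> i (x k)) *
         (\<Sum>i\<in>{1..p}. Cd i (j (d-1)) m * \<Psi> i (x d)) = e 1 (j 1) x *
         (\<Prod>k\<in>{2..d-1}. \<Sum>i\<in>{1..p}. C k i (j (k-1)) (j k) * \<Psi> i (x k)) *
         (\<Sum>i\<in>{1..p}. Cd i (j (d-1)) m * \<Psi> i (x d))" by simp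
    qed
    also have "\<dots> =
        (\<Sum>a\<in>{1..card (F (d-1))}. e (d-1) a x * (\<Sum>i\<in>{1..p}. Cd i a m * \<Psi> i (x d)))"
      using d rec
      by (intro sum_over_paths[where A = "\<lambda>k b. e k b x"
            and G = "\<lambda>k a b. \<Sum>i\<in>{1..p}. C k i a b * \<Psi> i (x k)"]) auto
    also have "\<dots> = f m x"
      using cd[OF m x] sum_e[of "d-1"] d by (simp add: Cd_def)
    finally show ?thesis by simp
  qed
  thus ?thesis unfolding has_vector_tt_representation_def by blast
qed

lemma scalar_tt_from_constant_vector_tt:
  assumes "has_vector_tt_representation d p \<Psi> S (\<lambda>_. h) r" and "1 \<le> d"
  shows "has_tt_representation d p \<Psi> S h r"
proof -
  obtain C1 C Cd where "\<forall>m\<in>{1..d}. \<forall>x\<in>S.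
      h x = dictionary_expansion d p \<Psi> (tt_tensor d r C1 C (\<lambda>i j. Cd i j m)) x"
    using assms(1) unfolding has_vector_tt_representation_def by blast
  hence "\<forall>x\<in>S. h x = dictionary_expansion d p \<Psi> (tt_tensor d r C1 C (\<lambda>i j. Cd i j 1)) x"
    using assms(2) by simp
  thus ?thesis unfolding has_tt_representation_def by blast
qed

section \<open>Extending a family by functions of one more variable\<close>

lemma one_mode_extension_sum:
  assumes "finite T" and "\<And>t. t \<in> T \<Longrightarrow> h t \<in> one_mode_extension p \<Psi> S k F"
  shows "(\<lambda>x. \<Sum>t\<in>T. h t x) \<in> one_mode_extension p \<Psi> S k F"
proof -
  define c where "c t = extension_coefficients p \<Psi> S k F (h t)" for t
  have c: "h t x = (\<Sum>a\<in>F. a x * (\<Sum>i\<in>{1..p}. c t a i * \<Psi> i (x k)))"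
    if "t \<in> T" "x \<in> S" for t x
    unfolding c_def using assms(2) that by (blast intro: extension_coefficients)
  have "(\<Sum>t\<in>T. h t x) = (\<Sum>a\<in>F. a x * (\<Sum>i\<in>{1..p}. (\<Sum>t\<in>T. c t a i) * \<Psi> i (x k)))"
    if "x \<in> S" for x
  proof -
    have "(\<Sum>t\<in>T. h t x) = (\<Sum>t\<in>T. \<Sum>a\<in>F. a x * (\<Sum>i\<in>{1..p}. c t a i * \<Psi> i (x k)))"
      using c that by simp
    also have "\<dots> = (\<Sum>a\<in>F. a x * (\<Sum>t\<in>T. \<Sum>i\<in>{1..p}. c t a i * \<Psi> i (x k)))"
      by (subst sum.swap) (simp add: sum_distrib_left)
    also have "\<dots> = (\<Sum>a\<in>F. a x * (\<Sum>i\<in>{1..p}. \<Sum>t\<in>T. c t a i * \<Psi> i (x k)))"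
      by (subst sum.swap) simp
    finally show ?thesis by (simp add: sum_distrib_right)
  qed
  thus ?thesis unfolding one_mode_extension_def
    by (intro CollectI exI[of _ "\<lambda>a i. \<Sum>t\<in>T. c t a i"]) blast
qed

lemma one_mode_extension_add:
  assumes "h \<in> one_mode_extension p \<Psi> S k F" and "h' \<in> one_mode_extension p \<Psi> S k F"
  shows "(\<lambda>x. h x + h' x) \<in> one_mode_extension p \<Psi> S k F"
  using one_mode_extension_sum[of "UNIV :: bool set" "\<lambda>b. if b then h else h'"] assms
  by (simp add: UNIV_bool add.commute)

lemma span_dictionary_coefficients:
  assumes "u \<in> real_fun.span (\<Psi> ` {1..p})"
  obtains \<alpha> where "\<And>t. u t = (\<Sum>i\<in>{1..p::nat}. \<alpha> i * \<Psi> i t)"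
proof -
  have "\<exists>\<alpha>. \<forall>t. u t = (\<Sum>i\<in>{1..p}. \<alpha> i * \<Psi> i t)"
    using assms
  proof (induction rule: real_fun.span_induct_alt)
    case base
    show ?case by (intro exI[of _ "\<lambda>_. 0"]) simp
  next
    case (step c v w)
    then obtain i \<alpha> where i: "i \<in> {1..p}" "v = \<Psi> i" and w: "\<And>t. w t = (\<Sum>i\<in>{1..p}. \<alpha> i * \<Psi> i t)"
      by blast
    have "c * \<Psi> i t + w t = (\<Sum>i'\<in>{1..p}. (\<alpha> i' + (if i' = i then c else 0)) * \<Psi> i' t)" for t
      using i(1) by (simp add: w distrib_right sum.distrib if_distrib[of "\<lambda>a. a * _"] cong: if_cong)
    thus ?case using i(2) by (intro exI[of _ "\<lambda>i'. \<alpha> i' + (if i' = i then c else 0)"]) simp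
  qed
  thus ?thesis using that by blast
qed

lemma one_mode_extension_times:
  assumes "finite F" and "a \<in> F" and "u \<in> real_fun.span (\<Psi> ` {1..p})"
  shows "(\<lambda>x. a x * u (x k)) \<in> one_mode_extension p \<Psi> S k F"
proof -
  obtain \<alpha> where \<alpha>: "\<And>t. u t = (\<Sum>i\<in>{1..p}. \<alpha> i * \<Psi> i t)"
    using span_dictionary_coefficients[OF assms(3)] by blast
  have "(\<Sum>a'\<in>F. a' x * (\<Sum>i\<in>{1..p}. (if a' = a then \<alpha> i else 0) * \<Psi> i (x k))) =
      (\<Sum>a'\<in>F. if a' = a then a x * u (x k) else 0)" for x
    by (intro sum.cong) (auto simp: \<alpha>)
  thus ?thesis using assms(1,2) unfolding one_mode_extension_def
    by (intro CollectI exI[of _ "\<lambda>a' i. if a' = a then \<alpha> i else 0"]) simp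
qed

lemma one_mode_extension_superset:
  assumes "finite F" and "a \<in> F" and "(\<lambda>_. 1) \<in> real_fun.span (\<Psi> ` {1..p})"
  shows "a \<in> one_mode_extension p \<Psi> S k F"
  using one_mode_extension_times[OF assms] by simp

lemma one_mode_extension_cong:
  assumes "h \<in> one_mode_extension p \<Psi> S k F" and "\<And>x. x \<in> S \<Longrightarrow> h' x = h x"
  shows "h' \<in> one_mode_extension p \<Psi> S k F"
  using assms unfolding one_mode_extension_def by simp

section \<open>Interacting modes\<close>

text \<open>
  The mode sets that may occur in the component \<open>m\<close> when only the modes in \<open>V\<close> are available:
  \<open>V = {1..d}\<close> gives all of them, \<open>V = {1..k}\<close> those to the left of a cut.
\<close>

definition interaction_sets :: "nat set \<Rightarrow> nat \<Rightarrow> nat \<Rightarrow> nat set set"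
  where "interaction_sets V K m = {J. J \<subseteq> V \<and> card J = K \<and> m \<in> J}"

lemma finite_interaction_sets: "finite V \<Longrightarrow> finite (interaction_sets V K m)"
  by (rule finite_subset[of _ "Pow V"]) (auto simp: interaction_sets_def)

lemma finite_interaction_tuples:
  assumes "finite V" and "J \<in> interaction_sets V K m" and "A \<subseteq> (J \<rightarrow>\<^sub>E {1..q::nat})"
  shows "finite A"
proof -
  have "finite J" using assms(1,2) by (auto simp: interaction_sets_def intro: finite_subset)
  hence "finite (J \<rightarrow>\<^sub>E {1..q})" by (intro finite_PiE) auto
  thus ?thesis using assms(3) by (rule rev_finite_subset)
qed

text \<open>
  Removing \<open>m\<close> leaves an arbitrary set of \<open>K - 1\<close> other elements of \<open>V\<close>.
\<close>

lemma card_interaction_sets: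
  assumes "finite V" and "m \<in> V" and "1 \<le> K"
  shows "card (interaction_sets V K m) = (card V - 1) choose (K - 1)"
proof -
  let ?B = "{B. B \<subseteq> V - {m} \<and> card B = K - 1}"
  have "interaction_sets V K m = insert m ` ?B"
  proof (intro equalityI subsetI)
    fix J assume J: "J \<in> interaction_sets V K m"
    hence "J - {m} \<in> ?B" "J = insert m (J - {m})"
      by (auto simp: interaction_sets_def)
    thus "J \<in> insert m ` ?B" by (rule rev_image_eqI)
  next
    fix J assume "J \<in> insert m ` ?B"
    then obtain B where B: "B \<subseteq> V - {m}" "card B = K - 1" "J = insert m B" by auto
    have "finite B" "m \<notin> B" using B(1) assms(1) by (auto intro: finite_subset)
    thus "J \<in> interaction_sets V K m" using B assms by (auto simp: interaction_sets_def)
  qed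
  moreover have "inj_on (insert m) ?B" by (auto intro!: inj_onI)
  ultimately have "card (interaction_sets V K m) = card ?B" by (simp add: card_image)
  also have "\<dots> = (card (V - {m}) choose (K - 1))"
    using assms by (intro n_subsets) auto
  finally show ?thesis using assms by simp
qed

lemma card_pointed_interaction_sets:
  assumes "finite V" and "1 \<le> K"
  shows "card (SIGMA m:V. interaction_sets V K m) = card V * ((card V - 1) choose (K - 1))"
  using assms by (simp add: card_SigmaI finite_interaction_sets card_interaction_sets)

lemma card_UN_family_le:
  assumes "finite T" and "\<And>t. t \<in> T \<Longrightarrow> finite (A t)" and "\<And>t. t \<in> T \<Longrightarrow> card (A t) \<le> N"
  shows "card (\<Union>t\<in>T. h t ` A t) \<le> N * card T"
proof -
  have "card (\<Union>t\<in>T. h t ` A t) \<le> (\<Sum>t\<in>T. card (h t ` A t))" by (rule card_UN_le[OF assms(1)])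
  also have "\<dots> \<le> (\<Sum>t\<in>T. N)"
    using assms by (intro sum_mono) (meson card_image_le order_trans)
  finally show ?thesis by (simp add: mult.commute)
qed

text \<open>
  Instead of enumerating the mode sets that occur in a component, the sum can run over all
  admissible ones, with no index tuples attached to those that do not occur.  Injectivity of the
  enumeration is what makes this well defined and keeps the bound \<open>N\<close> per mode set.
\<close>

lemma kmode_interacting_system_terms:
  assumes "kmode_interacting_system d S K N q g f"
  shows "\<exists>I. \<forall>m\<in>{1..d}.
      (\<forall>J\<in>interaction_sets {1..d} K m. I m J \<subseteq> (J \<rightarrow>\<^sub>E {1..q}) \<and> card (I m J) \<le> N) \<and>
      (\<forall>x\<in>S. f m x =
        (\<Sum>J\<in>interaction_sets {1..d} K m. \<Sum>i\<in>I m J. \<Prod>j\<in>J. g (i j) (x j)))"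
proof -
  have "\<exists>I. (\<forall>J\<in>interaction_sets {1..d} K m. I J \<subseteq> (J \<rightarrow>\<^sub>E {1..q}) \<and> card (I J) \<le> N) \<and>
    (\<forall>x\<in>S. f m x = (\<Sum>J\<in>interaction_sets {1..d} K m. \<Sum>i\<in>I J. \<Prod>j\<in>J. g (i j) (x j)))"
    if m: "m \<in> {1..d}" for m
  proof -
    from assms m have "\<exists>(L::nat) J I. inj_on J {1..L} \<and>
       (\<forall>l\<in>{1..L}. J l \<subseteq> {1..d} \<and> card (J l) = K \<and> m \<in> J l \<and>
          I l \<subseteq> (J l \<rightarrow>\<^sub>E {1..q}) \<and> card (I l) \<le> N) \<and>
       (\<forall>x\<in>S. f m x = (\<Sum>l\<in>{1..L}. \<Sum>i\<in>I l. \<Prod>j\<in>J l. g (i j) (x j)))"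
      unfolding kmode_interacting_system_def by (rule bspec)
    then obtain L :: nat and J I where inj: "inj_on J {1..L}" and
      JI: "\<forall>l\<in>{1..L}. J l \<subseteq> {1..d} \<and> card (J l) = K \<and> m \<in> J l \<and>
          I l \<subseteq> (J l \<rightarrow>\<^sub>E {1..q}) \<and> card (I l) \<le> N" and
      f: "\<forall>x\<in>S. f m x = (\<Sum>l\<in>{1..L}. \<Sum>i\<in>I l. \<Prod>j\<in>J l. g (i j) (x j))"
      by (elim exE conjE)
    define I' where "I' A = (if A \<in> J ` {1..L} then I (the_inv_into {1..L} J A) else {})" for A
    have I'J: "I' (J l) = I l" if "l \<in> {1..L}" for l
      using that inj by (simp add: I'_def the_inv_into_f_f)
    have sub: "J ` {1..L} \<subseteq> interaction_sets {1..d} K m"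
      using JI by (auto simp: interaction_sets_def)
    have "f m x = (\<Sum>A\<in>interaction_sets {1..d} K m. \<Sum>i\<in>I' A. \<Prod>j\<in>A. g (i j) (x j))"
      if "x \<in> S" for x
    proof -
      have "f m x = (\<Sum>l\<in>{1..L}. \<Sum>i\<in>I' (J l). \<Prod>j\<in>J l. g (i j) (x j))"
        using f that I'J by simp
      also have "\<dots> = (\<Sum>A\<in>J ` {1..L}. \<Sum>i\<in>I' A. \<Prod>j\<in>A. g (i j) (x j))"
        by (simp only: sum.reindex[OF inj] o_def)
      also have "\<dots> = (\<Sum>A\<in>interaction_sets {1..d} K m. \<Sum>i\<in>I' A. \<Prod>j\<in>A. g (i j) (x j))"
        by (rule sum.mono_neutral_left[OF finite_interaction_sets sub]) (auto simp: I'_def)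
      finally show ?thesis .
    qed
    moreover have "I' A \<subseteq> (A \<rightarrow>\<^sub>E {1..q}) \<and> card (I' A) \<le> N" for A
    proof (cases "A \<in> J ` {1..L}")
      case True
      then obtain l where "l \<in> {1..L}" "A = J l" by blast
      thus ?thesis using I'J JI by simp
    qed (simp add: I'_def)
    ultimately show ?thesis by blast
  qed
  then have "\<forall>m\<in>{1..d}. \<exists>I.
      (\<forall>J\<in>interaction_sets {1..d} K m. I J \<subseteq> (J \<rightarrow>\<^sub>E {1..q}) \<and> card (I J) \<le> N) \<and>
      (\<forall>x\<in>S. f m x = (\<Sum>J\<in>interaction_sets {1..d} K m. \<Sum>i\<in>I J. \<Prod>j\<in>J. g (i j) (x j)))"
    by (rule ballI)
  from bchoice[OF this] show ?thesis .
qed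

definition partial_product ::
  "(nat \<Rightarrow> real \<Rightarrow> real) \<Rightarrow> nat set \<Rightarrow> nat \<Rightarrow> (nat \<Rightarrow> nat) \<Rightarrow> (nat \<Rightarrow> real) \<Rightarrow> real"
  where "partial_product g J k i x = (\<Prod>j\<in>J \<inter> {1..k}. g (i j) (x j))"

lemma partial_product_step:
  assumes "1 \<le> k"
  shows "partial_product g J k i x =
    partial_product g J (k-1) i x * (if k \<in> J then g (i k) (x k) else 1)"
proof -
  have "{1..k} = insert k {1..k-1}" using assms by auto
  thus ?thesis using assms by (auto simp: partial_product_def Int_insert_right)
qed

text \<open>
  A partial product grows by one factor per mode; modes outside \<open>J\<close> contribute the constant
  \<open>1\<close>, which is why the dictionary has to span it.
\<close>

lemma partial_product_in_extension:
  assumes "1 \<le> k" and "finite F" and "partial_product g J (k-1) i \<in> F"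
    and "i \<in> J \<rightarrow>\<^sub>E {1..q}"
    and one: "(\<lambda>_. 1) \<in> real_fun.span (\<Psi> ` {1..p})"
    and g: "\<forall>i\<in>{1..q}. g i \<in> real_fun.span (\<Psi> ` {1..p})"
  shows "partial_product g J k i \<in> one_mode_extension p \<Psi> S k F"
proof -
  define u where "u = (if k \<in> J then g (i k) else (\<lambda>_. 1))"
  have "u \<in> real_fun.span (\<Psi> ` {1..p})"
    using assms by (auto simp: u_def PiE_iff)
  from one_mode_extension_times[OF assms(2,3) this, of k S] show ?thesis
    by (rule one_mode_extension_cong) (auto simp: u_def partial_product_step[OF assms(1)])
qed

section \<open>Representation of a single component\<close>

text \<open>
  The states are the partial products of all terms of the component, so that no rank exceeds the
  number of terms.
\<close>

lemma component_tt_representation: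
  fixes g :: "nat \<Rightarrow> real \<Rightarrow> real"
  assumes d: "2 \<le> d" and K: "1 \<le> K" and m: "m \<in> {1..d}"
    and I: "\<And>J. J \<in> interaction_sets {1..d} K m \<Longrightarrow>
       I J \<subseteq> (J \<rightarrow>\<^sub>E {1..q}) \<and> card (I J) \<le> N"
    and h: "\<And>x. x \<in> S \<Longrightarrow>
       h x = (\<Sum>J\<in>interaction_sets {1..d} K m. \<Sum>i\<in>I J. \<Prod>j\<in>J. g (i j) (x j))"
    and one: "(\<lambda>_. 1) \<in> real_fun.span (\<Psi> ` {1..p})"
    and g: "\<forall>i\<in>{1..q}. g i \<in> real_fun.span (\<Psi> ` {1..p})"
  shows "has_tt_representation_rank d p \<Psi> S h (N * ((d - 1) choose (K - 1)))"
proof -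
  let ?T = "interaction_sets {1..d} K m"
  \<comment> \<open>At \<open>k = 0\<close> all partial products are \<open>1\<close>, but without any term the family would be empty.\<close>
  define F where "F k = (if k = 0 then {\<lambda>_. 1} else (\<Union>J\<in>?T. partial_product g J k ` I J))" for k
  have J_sub: "J \<subseteq> {1..d}" if "J \<in> ?T" for J using that by (simp add: interaction_sets_def)
  have finT: "finite ?T" by (simp add: finite_interaction_sets)
  have finI: "finite (I J)" if "J \<in> ?T" for J
    using finite_interaction_tuples[OF _ that, of "I J" q] I[OF that] by simp
  have finF: "finite (F k)" for k using finT finI by (simp add: F_def)
  have in_F: "partial_product g J k i \<in> F k" if "J \<in> ?T" "i \<in> I J" for J k i
    using that by (auto simp: F_def partial_product_def fun_eq_iff)
  have ext: "partial_product g J k i \<in> one_mode_extension p \<Psi> S k (F (k-1))"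
    if "J \<in> ?T" "i \<in> I J" "1 \<le> k" for J k i
  proof -
    have "i \<in> J \<rightarrow>\<^sub>E {1..q}" using I[OF that(1)] that(2) by blast
    from partial_product_in_extension[OF that(3) finF in_F[OF that(1,2)] this one g] show ?thesis .
  qed
  have nested: "F k \<subseteq> one_mode_extension p \<Psi> S k (F (k-1))" if "k \<in> {1..d-1}" for k
  proof -
    have "F k = (\<Union>J\<in>?T. partial_product g J k ` I J)" using that by (simp add: F_def)
    hence "\<exists>J\<in>?T. \<exists>i\<in>I J. h = partial_product g J k i" if "h \<in> F k" for h
      using that by auto
    moreover have "partial_product g J k i \<in> one_mode_extension p \<Psi> S k (F (k-1))"
      if "J \<in> ?T" "i \<in> I J" for J i
      using ext[OF that] \<open>k \<in> {1..d-1}\<close> by simp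
    ultimately show ?thesis by blast
  qed
  have last: "h \<in> one_mode_extension p \<Psi> S d (F (d-1))"
  proof (rule one_mode_extension_cong)
    show "(\<lambda>x. \<Sum>J\<in>?T. \<Sum>i\<in>I J. partial_product g J d i x) \<in> one_mode_extension p \<Psi> S d (F (d-1))"
    proof (intro one_mode_extension_sum finT finI)
      fix J i assume "J \<in> ?T" "i \<in> I J"
      thus "partial_product g J d i \<in> one_mode_extension p \<Psi> S d (F (d-1))"
        using d by (intro ext) simp_all
    qed
    show "h x = (\<Sum>J\<in>?T. \<Sum>i\<in>I J. partial_product g J d i x)" if "x \<in> S" for x
      unfolding h[OF that] partial_product_def using J_sub
      by (intro sum.cong refl prod.cong) auto
  qed
  have "F 0 = {\<lambda>_. 1}" by (simp add: F_def)
  hence "has_vector_tt_representation d p \<Psi> S (\<lambda>_. h) (\<lambda>k. card (F k))"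
    by (rule vector_tt_from_nested_families[OF d _ finF nested last])
  hence "has_tt_representation d p \<Psi> S h (\<lambda>k. card (F k))"
    using d by (intro scalar_tt_from_constant_vector_tt) auto
  moreover have "card (F k) \<le> N * ((d - 1) choose (K - 1))" if "k \<in> {1..d-1}" for k
  proof -
    have "card (F k) = card (\<Union>J\<in>?T. partial_product g J k ` I J)"
      using that by (simp add: F_def)
    also have "\<dots> \<le> N * card ?T" using finI I by (intro card_UN_family_le finT) auto
    finally show ?thesis using m K by (simp add: card_interaction_sets)
  qed
  ultimately show ?thesis unfolding has_tt_representation_rank_def
    by (intro exI[of _ "\<lambda>k. card (F k)"] conjI ballI)
qed

section \<open>Representation of the vector-valued function\<close>

text \<open>
  The part of the component \<open>m\<close> whose products are finished at the cut \<open>k\<close>.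
\<close>

definition left_component ::
  "(nat \<Rightarrow> real \<Rightarrow> real) \<Rightarrow> nat \<Rightarrow> (nat \<Rightarrow> nat set \<Rightarrow> (nat \<Rightarrow> nat) set) \<Rightarrow> nat \<Rightarrow> nat \<Rightarrow>
     (nat \<Rightarrow> real) \<Rightarrow> real"
  where "left_component g K I k m x =
    (\<Sum>J\<in>interaction_sets {1..k} K m. \<Sum>i\<in>I m J. \<Prod>j\<in>J. g (i j) (x j))"

definition crossing_sets :: "nat \<Rightarrow> nat \<Rightarrow> nat \<Rightarrow> (nat \<times> nat set) set"
  where "crossing_sets d K k = {(m, J). m \<in> {1..d} \<and> J \<in> interaction_sets {1..d} K m \<and>
    J \<inter> {1..k} \<noteq> {} \<and> \<not> J \<subseteq> {1..k}}"

text \<open>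
  Among the pairs \<open>(m, J)\<close> with \<open>m \<in> J\<close>, those whose \<open>J\<close> does not cross the cut lie
  entirely in the \<open>k\<close> modes on its left or in the \<open>d - k\<close> modes on its right.  Each of the three
  products in \<open>c2\<close> counts the pairs inside one of these sets of modes.
\<close>

lemma card_crossing_sets:
  assumes "k \<le> d" and "1 \<le> K"
  shows "real N * real (card (crossing_sets d K k)) = c2 K N d k"
proof -
  let ?P = "\<lambda>V. SIGMA m:V. interaction_sets V K m"
  have fin: "finite (?P V)" if "finite V" for V using that by (simp add: finite_interaction_sets)
  have fin_cross: "finite (crossing_sets d K k)"
    by (rule finite_subset[OF _ fin[of "{1..d}"]]) (auto simp: crossing_sets_def)
  have "?P {1..d} = crossing_sets d K k \<union> (?P {1..k} \<union> ?P {k+1..d})"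
    (is "?A = ?B")
  proof (intro equalityI subsetI)
    fix z assume "z \<in> ?A"
    then obtain m J where z: "z = (m, J)" "m \<in> {1..d}" "J \<subseteq> {1..d}" "card J = K" "m \<in> J"
      by (auto simp: interaction_sets_def)
    have "J \<subseteq> {k+1..d}" if "J \<inter> {1..k} = {}"
      using that z(3) by (auto simp: disjoint_iff subset_iff not_le)
    thus "z \<in> ?B" using z by (auto simp: crossing_sets_def interaction_sets_def)
  next
    fix z assume "z \<in> ?B"
    thus "z \<in> ?A" using assms(1) by (fastforce simp: crossing_sets_def interaction_sets_def)
  qed
  moreover have "crossing_sets d K k \<inter> (?P {1..k} \<union> ?P {k+1..d}) = {}"
    by (auto simp: crossing_sets_def interaction_sets_def)
  moreover have "?P {1..k} \<inter> ?P {k+1..d} = {}"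
    by auto
  ultimately have "card (?P {1..d}) =
      card (crossing_sets d K k) + (card (?P {1..k}) + card (?P {k+1..d}))"
    using fin_cross fin by (simp add: card_Un_disjoint)
  hence "d * ((d-1) choose (K-1)) = card (crossing_sets d K k) +
      (k * ((k-1) choose (K-1)) + (d-k) * ((d-k-1) choose (K-1)))"
    using assms(2) by (simp add: card_pointed_interaction_sets)
  thus ?thesis unfolding c2_def by simp
qed

text \<open>
  The products that are finished at \<open>k\<close> were either finished at \<open>k - 1\<close> already, and then
  their sum is a member of \<open>F\<close> or empty, or they contain the mode \<open>k\<close>.  In the latter case
  they arise by the factor for \<open>k\<close> from a partial product which crosses the cut \<open>k - 1\<close>,
  or from \<open>1\<close> if \<open>J = {k}\<close>.
\<close>

lemma left_component_in_extension:
  assumes k: "1 \<le> k" and F: "finite F" "(\<lambda>_. 1) \<in> F"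
    and left: "K \<le> k - 1 \<Longrightarrow> m \<le> k - 1 \<Longrightarrow> left_component g K I (k-1) m \<in> F"
    and cross: "\<And>J i. J \<in> interaction_sets {1..k} K m \<Longrightarrow> k \<in> J \<Longrightarrow> J \<inter> {1..k-1} \<noteq> {} \<Longrightarrow>
       i \<in> I m J \<Longrightarrow> partial_product g J (k-1) i \<in> F"
    and I: "\<And>J. J \<in> interaction_sets {1..k} K m \<Longrightarrow> I m J \<subseteq> (J \<rightarrow>\<^sub>E {1..q})"
    and one: "(\<lambda>_. 1) \<in> real_fun.span (\<Psi> ` {1..p})"
    and g: "\<forall>i\<in>{1..q}. g i \<in> real_fun.span (\<Psi> ` {1..p})"
  shows "left_component g K I k m \<in> one_mode_extension p \<Psi> S k F"
proof -
  let ?T = "{J \<in> interaction_sets {1..k} K m. k \<in> J}"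
  have split: "interaction_sets {1..k} K m = interaction_sets {1..k-1} K m \<union> ?T"
  proof -
    have "{1..k} = insert k {1..k-1}" using k by auto
    thus ?thesis by (auto simp: interaction_sets_def)
  qed
  have disj: "interaction_sets {1..k-1} K m \<inter> ?T = {}"
    using k by (auto simp: interaction_sets_def)
  have finT: "finite ?T" by (simp add: finite_interaction_sets)
  have finI: "finite (I m J)" if "J \<in> ?T" for J
    using finite_interaction_tuples[of "{1..k}" J K m "I m J" q] I[of J] that by simp
  have "left_component g K I (k-1) m \<in> one_mode_extension p \<Psi> S k F"
  proof (cases "K \<le> k - 1 \<and> m \<le> k - 1")
    case True
    thus ?thesis using left F one by (intro one_mode_extension_superset) auto
  next
    case False
    \<comment> \<open>A set with \<open>K\<close> elements that contains \<open>m\<close> does not fit into \<open>{1..k-1}\<close>.\<close>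
    have "interaction_sets {1..k-1} K m = {}"
      using False card_mono[of "{1..k-1}"] by (fastforce simp: interaction_sets_def)
    hence "left_component g K I (k-1) m = (\<lambda>_. 0)"
      by (simp add: left_component_def fun_eq_iff)
    thus ?thesis using one_mode_extension_sum[of "{}"] by simp
  qed
  moreover have "(\<lambda>x. \<Sum>J\<in>?T. \<Sum>i\<in>I m J. partial_product g J k i x) \<in> one_mode_extension p \<Psi> S k F"
  proof (intro one_mode_extension_sum finT finI)
    fix J i assume J: "J \<in> ?T" and i: "i \<in> I m J"
    have "partial_product g J (k-1) i \<in> F"
    proof (cases "J \<inter> {1..k-1} = {}")
      case True
      hence "partial_product g J (k-1) i = (\<lambda>_. 1)"
        by (auto simp: partial_product_def fun_eq_iff)
      thus ?thesis using F by simp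
    next
      case False
      thus ?thesis using cross J i by blast
    qed
    thus "partial_product g J k i \<in> one_mode_extension p \<Psi> S k F"
      using J i I by (intro partial_product_in_extension[OF k F(1) _ _ one g]) auto
  qed
  ultimately have "(\<lambda>x. left_component g K I (k-1) m x +
      (\<Sum>J\<in>?T. \<Sum>i\<in>I m J. partial_product g J k i x)) \<in> one_mode_extension p \<Psi> S k F"
    by (rule one_mode_extension_add)
  moreover have "left_component g K I k m x = left_component g K I (k-1) m x +
      (\<Sum>J\<in>?T. \<Sum>i\<in>I m J. partial_product g J k i x)" for x
  proof -
    have "(\<Sum>J\<in>?T. \<Sum>i\<in>I m J. partial_product g J k i x) =
        (\<Sum>J\<in>?T. \<Sum>i\<in>I m J. \<Prod>j\<in>J. g (i j) (x j))"
      unfolding partial_product_def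
      by (intro sum.cong refl prod.cong) (auto simp: interaction_sets_def)
    thus ?thesis unfolding left_component_def
      by (subst split, subst sum.union_disjoint[OF _ finT disj])
         (simp_all add: finite_interaction_sets)
  qed
  ultimately show ?thesis by (rule one_mode_extension_cong)
qed

text \<open>
  The states at the cut \<open>k\<close> are the constant \<open>1\<close> for everything still to come, one sum \<open>L\<close> of
  finished products per component, and the crossing partial products \<open>X\<close>.
\<close>

lemma vector_tt_representation:
  fixes g :: "nat \<Rightarrow> real \<Rightarrow> real"
  assumes d: "2 \<le> d" and K: "1 \<le> K"
    and I: "\<And>m J. m \<in> {1..d} \<Longrightarrow> J \<in> interaction_sets {1..d} K m \<Longrightarrow>
       I m J \<subseteq> (J \<rightarrow>\<^sub>E {1..q}) \<and> card (I m J) \<le> N"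
    and f: "\<And>m x. m \<in> {1..d} \<Longrightarrow> x \<in> S \<Longrightarrow>
       f m x = (\<Sum>J\<in>interaction_sets {1..d} K m. \<Sum>i\<in>I m J. \<Prod>j\<in>J. g (i j) (x j))"
    and one: "(\<lambda>_. 1) \<in> real_fun.span (\<Psi> ` {1..p})"
    and g: "\<forall>i\<in>{1..q}. g i \<in> real_fun.span (\<Psi> ` {1..p})"
  shows "\<exists>r :: nat \<Rightarrow> nat.
      (\<forall>k\<in>{1..d-1}. real (r k) \<le> c2 K N d k + real (k * ((k - 1) choose (K - 1))) + 1) \<and>
      has_vector_tt_representation d p \<Psi> S f r"
proof -
  \<comment> \<open>Sums of finished products vanish for \<open>k < K\<close>; the rank bound leaves no room for them there.\<close>
  define L where "L k = left_component g K I k ` {m. 1 \<le> m \<and> m \<le> k \<and> K \<le> k}" for k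
  define X where "X k = (\<Union>(m, J)\<in>crossing_sets d K k. partial_product g J k ` I m J)" for k
  define F where "F k = insert (\<lambda>_. 1) (L k \<union> X k)" for k
  have fin_cross: "finite (crossing_sets d K k)" for k
    by (rule finite_subset[of _ "{1..d} \<times> Pow {1..d}"])
       (auto simp: crossing_sets_def interaction_sets_def)
  have finI: "finite (I m J)" if "m \<in> {1..d}" "J \<in> interaction_sets {1..d} K m" for m J
    using finite_interaction_tuples[OF _ that(2), of "I m J" q] I[OF that] by simp
  have finM: "finite {m. 1 \<le> m \<and> m \<le> k \<and> K \<le> k}" for k
    by (rule finite_subset[of _ "{1..k}"]) auto
  have finL: "finite (L k)" for k
    unfolding L_def using finM by (rule finite_imageI)
  have finX: "finite (X k)" for k
    unfolding X_def using fin_cross finI by (auto simp: crossing_sets_def)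
  have finF: "finite (F k)" for k using finL finX by (simp add: F_def)
  have mono: "J \<in> interaction_sets {1..d} K m" if "J \<in> interaction_sets {1..k} K m" "k \<le> d" for J k m
    using that by (fastforce simp: interaction_sets_def)
  have in_F: "partial_product g J k i \<in> F k"
    if "m \<in> {1..d}" "J \<in> interaction_sets {1..d} K m" "\<not> J \<subseteq> {1..k}" "i \<in> I m J" for m J k i
  proof (cases "J \<inter> {1..k} = {}")
    case True
    hence "partial_product g J k i = (\<lambda>_. 1)" by (auto simp: partial_product_def fun_eq_iff)
    thus ?thesis by (simp add: F_def)
  next
    case False
    hence "(m, J) \<in> crossing_sets d K k" using that by (auto simp: crossing_sets_def)
    thus ?thesis using that(4) unfolding F_def X_def by blast
  qed
  have left_ext: "left_component g K I k m \<in> one_mode_extension p \<Psi> S k (F (k-1))"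
    if m: "m \<in> {1..d}" and k: "k \<in> {1..d}" for m k
  proof (rule left_component_in_extension[OF _ finF _ _ _ _ one g])
    show "left_component g K I (k-1) m \<in> F (k-1)" if "K \<le> k - 1" "m \<le> k - 1"
      using that m by (auto simp: F_def L_def)
    show "partial_product g J (k-1) i \<in> F (k-1)"
      if "J \<in> interaction_sets {1..k} K m" "k \<in> J" "J \<inter> {1..k-1} \<noteq> {}" "i \<in> I m J" for J i
      using that k m mono[OF that(1)] by (intro in_F) auto
    show "I m J \<subseteq> (J \<rightarrow>\<^sub>E {1..q})" if "J \<in> interaction_sets {1..k} K m" for J
      using I[OF m mono[OF that]] k by auto
  qed (use k in \<open>auto simp: F_def\<close>)
  have "F k \<subseteq> one_mode_extension p \<Psi> S k (F (k-1))" if k: "k \<in> {1..d-1}" for k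
  proof
    fix h assume "h \<in> F k"
    then consider "h = (\<lambda>_. 1)" | m where "m \<in> {1..k}" "h = left_component g K I k m"
      | m J i where "(m, J) \<in> crossing_sets d K k" "i \<in> I m J" "h = partial_product g J k i"
      unfolding F_def L_def X_def by force
    thus "h \<in> one_mode_extension p \<Psi> S k (F (k-1))"
    proof cases
      case 1
      thus ?thesis using one finF by (intro one_mode_extension_superset) (auto simp: F_def)
    next
      case 2
      thus ?thesis using left_ext[of m k] k by auto
    next
      case 3
      hence mJ: "m \<in> {1..d}" "J \<in> interaction_sets {1..d} K m" "\<not> J \<subseteq> {1..k}"
        by (auto simp: crossing_sets_def)
      hence "\<not> J \<subseteq> {1..k-1}" by auto
      hence "partial_product g J (k-1) i \<in> F (k-1)" using mJ 3 by (intro in_F)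
      thus ?thesis unfolding 3(3) using k 3 I[OF mJ(1,2)]
        by (intro partial_product_in_extension[OF _ finF _ _ one g]) auto
    qed
  qed
  moreover have "f m \<in> one_mode_extension p \<Psi> S d (F (d-1))" if "m \<in> {1..d}" for m
  proof (rule one_mode_extension_cong)
    show "left_component g K I d m \<in> one_mode_extension p \<Psi> S d (F (d-1))"
      using left_ext[of m d] that d by simp
  qed (use f that in \<open>simp add: left_component_def\<close>)
  moreover have "F 0 = {\<lambda>_. 1}" using K by (auto simp: F_def L_def X_def crossing_sets_def)
  ultimately have "has_vector_tt_representation d p \<Psi> S f (\<lambda>k. card (F k))"
    using d finF by (intro vector_tt_from_nested_families) auto
  moreover have "real (card (F k)) \<le> c2 K N d k + real (k * ((k - 1) choose (K - 1))) + 1"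
    if k: "k \<in> {1..d-1}" for k
  proof -
    have "X k = (\<Union>t\<in>crossing_sets d K k. (\<lambda>i. partial_product g (snd t) k i) ` I (fst t) (snd t))"
      unfolding X_def by (simp add: case_prod_unfold)
    also have "card \<dots> \<le> N * card (crossing_sets d K k)"
      using fin_cross finI I by (intro card_UN_family_le) (auto simp: crossing_sets_def)
    finally have "real (card (X k)) \<le> real (N * card (crossing_sets d K k))" by linarith
    hence X: "real (card (X k)) \<le> c2 K N d k"
      using card_crossing_sets[of k d K N] k K by auto
    have L: "card (L k) \<le> k * ((k - 1) choose (K - 1))"
    proof (cases "K \<le> k")
      case True
      have "card (L k) \<le> card {1..k}"
        unfolding L_def by (rule order_trans[OF card_image_le[OF finM] card_mono]) auto
      moreover have "1 \<le> (k - 1) choose (K - 1)"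
        using True K by (simp add: Suc_leI)
      ultimately show ?thesis
        using mult_le_mono2[of 1 "(k-1) choose (K-1)" k] by (metis card_atLeastAtMost diff_Suc_1 mult_1_right order_trans)
    qed (simp add: L_def)
    have "card (F k) \<le> Suc (card (L k \<union> X k))" unfolding F_def by (rule card_insert_le_m1) auto
    also have "\<dots> \<le> Suc (card (L k) + card (X k))" using card_Un_le by simp
    finally have "real (card (F k)) \<le> real (card (L k)) + real (card (X k)) + 1" by linarith
    also have "\<dots> \<le> real (k * ((k - 1) choose (K - 1))) + c2 K N d k + 1"
      using X L by (intro add_mono) (simp_all only: of_nat_le_iff order_refl)
    finally show ?thesis by simp
  qed
  ultimately show ?thesis by (intro exI[of _ "\<lambda>k. card (F k)"] conjI ballI)
qed

section \<open>Growth of the rank bounds\<close>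

lemma binomial_pred_le_power: "(n - 1) choose j \<le> n ^ j"
proof -
  have "(n - 1) choose j \<le> (n - 1) ^ j"
    by (cases "j \<le> n - 1") (auto intro: binomial_le_pow simp: binomial_eq_0)
  also have "\<dots> \<le> n ^ j" by (intro power_mono) auto
  finally show ?thesis .
qed

lemma times_binomial_pred_le_power:
  assumes "k \<le> n" and "1 \<le> K"
  shows "k * ((k - 1) choose (K - 1)) \<le> n ^ K"
proof -
  have "k * ((k - 1) choose (K - 1)) \<le> k * k ^ (K - 1)"
    by (intro mult_le_mono2 binomial_pred_le_power)
  also have "\<dots> = k ^ K" using assms(2) by (simp add: power_eq_if)
  also have "\<dots> \<le> n ^ K" using assms(1) by (intro power_mono) auto
  finally show ?thesis .
qed

text \<open>
  Each of the three terms of \<open>c2\<close> is at most \<open>M * n ^ K\<close>.  The bound holds for every cut,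
  and hence uniformly in \<open>M\<close> and \<open>k\<close>.
\<close>

lemma abs_c2_le:
  assumes "k \<le> n" and "1 \<le> K"
  shows "\<bar>c2 K M n k\<bar> \<le> 3 * (real M * real n ^ K)"
proof -
  have bound: "real (l * ((l - 1) choose (K - 1))) \<le> real n ^ K" if "l \<le> n" for l
    using times_binomial_pred_le_power[OF that assms(2)]
    by (metis of_nat_le_iff of_nat_power)
  have "\<bar>real (n * ((n - 1) choose (K - 1))) - real (k * ((k - 1) choose (K - 1)))
      - real ((n - k) * ((n - k - 1) choose (K - 1)))\<bar> \<le> 3 * real n ^ K"
    using bound[of n] bound[of k] bound[of "n - k"] assms(1) by linarith
  from mult_left_mono[OF this, of "real M"] show ?thesis
    unfolding c2_def by (simp add: abs_mult)
qed

theorem theorem9: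
  fixes d K N p q :: nat
    and S :: "(nat \<Rightarrow> real) set"
    and f :: "nat \<Rightarrow> (nat \<Rightarrow> real) \<Rightarrow> real"
    and g \<Psi> :: "nat \<Rightarrow> real \<Rightarrow> real"
  assumes "2 \<le> d" and "1 \<le> K" and "K \<le> d" and "1 \<le> N"
    and "S \<subseteq> {1..d} \<rightarrow>\<^sub>E (UNIV :: real set)"
    and "kmode_interacting_system d S K N q g f"
    and "inj_on \<Psi> {1..p}" and "real_fun.independent (\<Psi> ` {1..p})"
    and "(\<lambda>_. 1) \<in> real_fun.span (\<Psi> ` {1..p})"
    and "\<forall>i\<in>{1..q}. g i \<in> real_fun.span (\<Psi> ` {1..p})"
  shows
    "((\<forall>k\<in>{1..d}. \<exists>r. r \<le> N * ((d - 1) choose (K - 1)) \<and>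
          has_tt_representation_rank d p \<Psi> S (f k) r) \<and>
      (\<lambda>n. real ((n - 1) choose (K - 1))) \<in> O(\<lambda>n. real n ^ (K - 1))) \<and>
     ((\<exists>r :: nat \<Rightarrow> nat.
          (\<forall>k\<in>{1..d-1}. real (r k) \<le> c2 K N d k + real (k * ((k - 1) choose (K - 1))) + 1) \<and>
          has_vector_tt_representation d p \<Psi> S f r) \<and>
      (\<lambda>(M, n, k). c2 K M n k) \<in> O[uniform_dim_at_top](\<lambda>(M, n, k). real M * real n ^ K))"
proof -
  obtain I where I: "\<forall>m\<in>{1..d}.
      (\<forall>J\<in>interaction_sets {1..d} K m. I m J \<subseteq> (J \<rightarrow>\<^sub>E {1..q}) \<and> card (I m J) \<le> N) \<and>
      (\<forall>x\<in>S. f m x =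
        (\<Sum>J\<in>interaction_sets {1..d} K m. \<Sum>i\<in>I m J. \<Prod>j\<in>J. g (i j) (x j)))"
    using kmode_interacting_system_terms[OF assms(6)] by (elim exE)
  have tuples: "I m J \<subseteq> (J \<rightarrow>\<^sub>E {1..q}) \<and> card (I m J) \<le> N"
    if "m \<in> {1..d}" "J \<in> interaction_sets {1..d} K m" for m J
    using I that by simp
  have f: "f m x = (\<Sum>J\<in>interaction_sets {1..d} K m. \<Sum>i\<in>I m J. \<Prod>j\<in>J. g (i j) (x j))"
    if "m \<in> {1..d}" "x \<in> S" for m x
    using I that by simp
  have components: "\<exists>r. r \<le> N * ((d - 1) choose (K - 1)) \<and> has_tt_representation_rank d p \<Psi> S (f k) r"
    if k: "k \<in> {1..d}" for k
    using component_tt_representation[OF assms(1,2) k tuples[OF k] f[OF k] assms(9,10)]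
    by (intro exI[of _ "N * ((d - 1) choose (K - 1))"] conjI order_refl)
  have "real ((n - 1) choose (K - 1)) \<le> real n ^ (K - 1)" for n
    using binomial_pred_le_power by (metis of_nat_le_iff of_nat_power)
  hence growth: "(\<lambda>n. real ((n - 1) choose (K - 1))) \<in> O(\<lambda>n. real n ^ (K - 1))"
    by (intro bigoI[of _ 1]) simp
  have "\<forall>\<^sub>F z in uniform_dim_at_top. z \<in> {(N, d, k). 1 \<le> N \<and> k \<in> {1..d-1}}"
    unfolding uniform_dim_at_top_def eventually_inf_principal by simp
  hence c2_growth: "(\<lambda>(M, n, k). c2 K M n k) \<in> O[uniform_dim_at_top](\<lambda>(M, n, k). real M * real n ^ K)"
    using abs_c2_le[OF _ assms(2)]
    by (intro bigoI[of _ 3]) (auto elim!: eventually_mono simp: abs_mult)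
  show ?thesis
    by (intro conjI ballI components growth c2_growth
          vector_tt_representation[OF assms(1,2) tuples f assms(9,10)])
qed

end
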